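(* For every prime $p$ and every integer $n \ge 1$, the function $\nu_p(\overline{G}_n) := \mathrm{ord}_p(\overline{G}_n)$ satisfies $$\nu_p(\overline{G}_n) = \mathrm{ord}_p(D_n^{\ast}) - \mathrm{ord}_p(N_n^{\ast}),$$ where $D_n^{\ast} = \prod_{k=1}^n k^k$ and $N_n^{\ast} = \prod_{k=1}^n k!$.
   Context: $\overline{G}_n := \prod_{k=0}^n \binom{n}{k}$. For a prime $p$ and a positive integer $m$, $\mathrm{ord}_p(m)$ is the exponent of the largest power of $p$ dividing $m$. *)

theory Defs
  imports "HOL-Computational_Algebra.Primes"
begin

definition Gbar :: "nat \<Rightarrow> nat" where
  "Gbar n = (\<Prod>k=0..n. n choose k)"

definition Dstar :: "nat \<Rightarrow> nat" where
  "Dstar n = (\<Prod>k=1..n. k ^ k)"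

definition Nstar :: "nat \<Rightarrow> nat" where
  "Nstar n = (\<Prod>k=1..n. fact k)"

end

theory Submission
  imports Defs
begin

text \<open>
  The valuation identity is the prime-by-prime shadow of the identity of positive integers
  \<open>Gbar n * Nstar n = Dstar n\<close>: multiplicities at a prime are additive on nonzero products.
  That identity follows by induction on \<open>n\<close>, because passing from row \<open>n\<close> of Pascal's triangle
  to row \<open>n + 1\<close> multiplies the row product by \<open>(n + 1) ^ (n + 1) / fact (n + 1)\<close>, which is exactly
  the factor by which the quotient of \<open>Dstar\<close> and \<open>Nstar\<close> grows.
\<close>

text \<open>
  Absorption turns each entry \<open>n choose k\<close> into \<open>Suc n choose k\<close> at the cost of the factor
  \<open>(n + 1) / (n + 1 - k)\<close>; over \<open>k = 0..n\<close> the denominators run through \<open>1..n + 1\<close> and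
  multiply to a factorial. The last entry of the new row is \<open>1\<close>.
\<close>

lemma Gbar_Suc: "Gbar (Suc n) * fact (Suc n) = Gbar n * Suc n ^ Suc n"
proof -
  have "Gbar (Suc n) * fact (Suc n)
      = (\<Prod>k=0..n. Suc n choose k) * (\<Prod>k=0..n. Suc n - k)"
    by (simp add: Gbar_def fact_prod_rev atLeastLessThanSuc_atLeastAtMost del: fact_Suc)
  also have "\<dots> = (\<Prod>k=0..n. (Suc n - k) * (Suc n choose k))"
    by (simp add: prod.distrib mult.commute)
  also have "\<dots> = (\<Prod>k=0..n. Suc n * (n choose k))"
    by (simp only: binomial_absorb_comp diff_Suc_1)
  also have "\<dots> = Gbar n * Suc n ^ Suc n"
    by (simp add: Gbar_def prod.distrib mult.commute del: mult_Suc)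
  finally show ?thesis .
qed

lemma Gbar_mult_Nstar: "Gbar n * Nstar n = Dstar n"
proof (induction n)
  case 0
  show ?case by (simp add: Gbar_def Nstar_def Dstar_def)
next
  case (Suc n)
  have "Gbar (Suc n) * Nstar (Suc n) = Nstar n * (Gbar (Suc n) * fact (Suc n))"
    by (simp add: Nstar_def del: fact_Suc)
  also have "\<dots> = (Gbar n * Nstar n) * Suc n ^ Suc n"
    by (simp only: Gbar_Suc mult_ac)
  also have "\<dots> = Dstar (Suc n)"
    by (simp add: Suc.IH Dstar_def)
  finally show ?case .
qed

theorem theorem4p1:
  fixes p n :: nat
  assumes "prime p" and "n \<ge> 1"
  shows "int (multiplicity p (Gbar n)) =
           int (multiplicity p (Dstar n)) - int (multiplicity p (Nstar n))"
proof -
  have "Gbar n \<noteq> 0" and "Nstar n \<noteq> 0"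
    by (auto simp: Gbar_def Nstar_def)
  then have "multiplicity p (Gbar n * Nstar n) = multiplicity p (Gbar n) + multiplicity p (Nstar n)"
    using \<open>prime p\<close> by (intro prime_elem_multiplicity_mult_distrib) auto
  then show ?thesis
    by (simp add: Gbar_mult_Nstar)
qed

end
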